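(* Let $A$ be a type, $P:A\to\mathbb{B}$ and $t:\mathsf{cotree}\,A$. Then $\mathsf{disjoint}(\mathsf{preimage}\,P\,t)$.
   Context: $\mathsf{cotree}\,X$ is the coinductive type with constructors $\bot$, $\mathsf{coleaf}\,x$, $\mathsf{conode}\,k$ ($k:\mathbb{B}\to\mathsf{cotree}\,X$), ordered coinductively by $\bot\sqsubseteq t$, $\mathsf{coleaf}\,x\sqsubseteq\mathsf{coleaf}\,x$, $\mathsf{conode}\,f\sqsubseteq\mathsf{conode}\,g$ when $f\,b\sqsubseteq g\,b$ for all $b$; order-equivalent cotrees are assumed equal (axiom). $\mathsf{tree}\,X$ is the inductive analogue (constructors $\bot,\mathsf{leaf},\mathsf{node}$); $\mathsf{idl}\,t\,i$ is the depth-$i$ truncation of $t$ (depth $0$ gives $\bot$). For monotone $h:\mathsf{tree}\,X\to C$, $\overline h(t):=\sup_i h(\mathsf{idl}\,t\,i)$ (chosen supremum). $\mathsf{fold}\,z\,f\,g$ on $\mathsf{tree}\,X$: $\bot\mapsto z$, $\mathsf{leaf}\,a\mapsto f\,a$, $\mathsf{node}\,k\mapsto g(\mathsf{fold}\,z\,f\,g\circ k)$. $\mathsf{map}\,h$ replaces each leaf $x$ of a cotree by $h\,x$. $\mathsf{lang}:=\overline{\mathsf{fold}\,\bot\,(\lambda\_.\,\mathsf{coleaf}\,\mathsf{nil})\,(\lambda g.\,\mathsf{conode}(\lambda b.\,\mathsf{map}\,(\mathsf{cons}\,b)\,(g\,b)))}$, $\mathsf{filter}\,P:=\overline{\mathsf{fold}\,\bot\,(\lambda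 a.\,\text{if }P\,a\text{ then }\mathsf{coleaf}\,a\text{ else }\bot)\,\mathsf{conode}}$, and $\mathsf{preimage}\,P:=\mathsf{lang}\circ\mathsf{filter}\,P : \mathsf{cotree}\,A\to\mathsf{cotree}(\mathsf{list}\,\mathbb{B})$. Lists of booleans are ordered by the prefix order; $x\bowtie y$ means $\neg(x\sqsubseteq y\lor y\sqsubseteq x)$. For an ordered type $X$, $\mathsf{disjoint}_{\mathsf{tree}}:\mathsf{tree}\,X\to\mathbb{P}$ is the inductive predicate: it holds of $\bot$ and of every $\mathsf{leaf}\,x$, and of $\mathsf{node}\,k$ whenever $\mathsf{disjoint}_{\mathsf{tree}}(k\,b)$ for both $b$ and every leaf value $x$ of $k\,\mathbf{true}$ and every leaf value $y$ of $k\,\mathbf{false}$ satisfy $x\bowtie y$. For $t:\mathsf{cotree}\,X$, $\mathsf{disjoint}\,t :\iff \forall i,\ \mathsf{disjoint}_{\mathsf{tree}}(\mathsf{idl}\,t\,i)$. *)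

theory Defs
  imports Main "HOL-Library.Prefix_Order"
begin

codatatype (coleaves: 'a) cotree =
    CoBot
  | CoLeaf 'a
  | CoNode "bool \<Rightarrow> 'a cotree"
  for map: map_cotree

datatype (leaves: 'a) tree =
    Bot
  | Leaf 'a
  | Node "bool \<Rightarrow> 'a tree"

coinductive cotree_le :: "'a cotree \<Rightarrow> 'a cotree \<Rightarrow> bool" where
  cotree_le_bot: "cotree_le CoBot t"
| cotree_le_leaf: "cotree_le (CoLeaf x) (CoLeaf x)"
| cotree_le_node: "(\<And>b. cotree_le (f b) (g b)) \<Longrightarrow> cotree_le (CoNode f) (CoNode g)"

inductive_simps cotree_le_simps [simp]:
  "cotree_le CoBot t"
  "cotree_le (CoLeaf x) t"
  "cotree_le (CoNode f) t"
  "cotree_le t CoBot"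

lemma cotree_le_refl: "cotree_le t t"
proof (coinduction arbitrary: t)
  case cotree_le
  then show ?case by (cases t) auto
qed

lemma cotree_le_trans: "cotree_le s t \<Longrightarrow> cotree_le t u \<Longrightarrow> cotree_le s u"
proof (coinduction arbitrary: s t u)
  case cotree_le
  then show ?case by (cases s rule: cotree.exhaust) (auto, blast)
qed

lemma cotree_le_antisym: "cotree_le s t \<Longrightarrow> cotree_le t s \<Longrightarrow> s = t"
proof (coinduction arbitrary: s t rule: cotree.coinduct_strong)
  case Eq_cotree
  then show ?case by (cases s rule: cotree.exhaust) (auto simp: rel_fun_def)
qed

instantiation cotree :: (type) order
begin

definition less_eq_cotree :: "'a cotree \<Rightarrow> 'a cotree \<Rightarrow> bool" where
  "s \<le> t \<longleftrightarrow> cotree_le s t"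

definition less_cotree :: "'a cotree \<Rightarrow> 'a cotree \<Rightarrow> bool" where
  "s < t \<longleftrightarrow> s \<le> t \<and> \<not> t \<le> (s :: 'a cotree)"

instance
  by standard
    (auto simp: less_eq_cotree_def less_cotree_def
      intro: cotree_le_refl cotree_le_trans cotree_le_antisym)

end

text \<open>
  Every chain of cotrees has a supremum: all its members different from \<open>CoBot\<close> have the same
  root, and the supremum is computed corecursively below that root.  On sets that are not chains
  the value is irrelevant.
\<close>

primcorec cotree_Sup :: "'a cotree set \<Rightarrow> 'a cotree" where
  "cotree_Sup A =
    (if \<exists>x. CoLeaf x \<in> A then CoLeaf (SOME x. CoLeaf x \<in> A)
     else if \<exists>k. CoNode k \<in> A then CoNode (\<lambda>b. cotree_Sup {k b | k. CoNode k \<in> A})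
     else CoBot)"

lemma chain_children:
  assumes "Complete_Partial_Order.chain cotree_le A"
  shows "Complete_Partial_Order.chain cotree_le {k b | k. CoNode k \<in> A}"
proof (rule chainI)
  fix x y assume "x \<in> {k b | k. CoNode k \<in> A}" "y \<in> {k b | k. CoNode k \<in> A}"
  then obtain k l where kl: "x = k b" "y = l b" "CoNode k \<in> A" "CoNode l \<in> A" by auto
  then have "cotree_le (CoNode k) (CoNode l) \<or> cotree_le (CoNode l) (CoNode k)"
    using assms by (auto dest: chainD)
  then show "cotree_le x y \<or> cotree_le y x" using kl by auto
qed

lemma cotree_Sup_upper:
  "Complete_Partial_Order.chain cotree_le A \<Longrightarrow> t \<in> A \<Longrightarrow> cotree_le t (cotree_Sup A)"
proof (coinduction arbitrary: A t)
  case cotree_le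
  note ch = \<open>Complete_Partial_Order.chain cotree_le A\<close> and tA = \<open>t \<in> A\<close>
  show ?case
  proof (cases t)
    case CoBot
    then show ?thesis by simp
  next
    case (CoLeaf x)
    have "(SOME x. CoLeaf x \<in> A) = x"
    proof (rule some_equality)
      show "CoLeaf x \<in> A" using tA CoLeaf by simp
    next
      fix y assume "CoLeaf y \<in> A"
      then show "y = x" using chainD[OF ch \<open>CoLeaf y \<in> A\<close> tA] CoLeaf by auto
    qed
    then have "cotree_Sup A = CoLeaf x" using tA CoLeaf by (subst cotree_Sup.code) auto
    then show ?thesis using CoLeaf by simp
  next
    case (CoNode k)
    have "\<not> (\<exists>x. CoLeaf x \<in> A)"
      using chainD[OF ch _ tA] CoNode by fastforce
    then have "cotree_Sup A = CoNode (\<lambda>b. cotree_Sup {k b | k. CoNode k \<in> A})"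
      using tA CoNode by (subst cotree_Sup.code) auto
    moreover have "\<exists>B s. k b = s \<and> cotree_Sup {k b | k. CoNode k \<in> A} = cotree_Sup B \<and>
        Complete_Partial_Order.chain cotree_le B \<and> s \<in> B" for b
      using chain_children[OF ch, of b] tA CoNode by blast
    ultimately show ?thesis using CoNode by auto
  qed
qed

lemma cotree_Sup_least:
  "\<forall>t \<in> A. cotree_le t u \<Longrightarrow> cotree_le (cotree_Sup A) u"
proof (coinduction arbitrary: A u)
  case cotree_le
  then have le: "cotree_le t u" if "t \<in> A" for t using that by blast
  consider (leaf) "\<exists>x. CoLeaf x \<in> A"
    | (node) "\<not> (\<exists>x. CoLeaf x \<in> A)" "\<exists>k. CoNode k \<in> A"
    | (bot) "\<not> (\<exists>x. CoLeaf x \<in> A)" "\<not> (\<exists>k. CoNode k \<in> A)"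
    by blast
  then show ?case
  proof cases
    case leaf
    then have "CoLeaf (SOME x. CoLeaf x \<in> A) \<in> A" by (rule someI_ex)
    from le[OF this] have "u = CoLeaf (SOME x. CoLeaf x \<in> A)" by simp
    moreover have "cotree_Sup A = CoLeaf (SOME x. CoLeaf x \<in> A)"
      using leaf by (subst cotree_Sup.code) auto
    ultimately show ?thesis by simp
  next
    case node
    then obtain k where "CoNode k \<in> A" by blast
    from le[OF this] obtain g where u: "u = CoNode g" by auto
    have "cotree_Sup A = CoNode (\<lambda>b. cotree_Sup {k b | k. CoNode k \<in> A})"
      using node by (subst cotree_Sup.code) auto
    moreover have "\<forall>t \<in> {k b | k. CoNode k \<in> A}. cotree_le t (g b)" for b
      using le u by force
    ultimately show ?thesis using u by auto
  next
    case bot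
    then have "cotree_Sup A = CoBot" by (subst cotree_Sup.code) auto
    then show ?thesis by simp
  qed
qed

instantiation cotree :: (type) ccpo
begin

definition Sup_cotree :: "'a cotree set \<Rightarrow> 'a cotree" where
  "Sup_cotree = cotree_Sup"

instance
proof
  have eq: "(\<le>) = (cotree_le :: 'a cotree \<Rightarrow> _)"
    by (intro ext) (simp add: less_eq_cotree_def)
  fix A :: "'a cotree set" and t
  assume ch: "Complete_Partial_Order.chain (\<le>) A"
  show "t \<le> Sup A" if "t \<in> A"
    using cotree_Sup_upper ch that by (simp add: eq Sup_cotree_def)
  show "Sup A \<le> t" if "\<And>s. s \<in> A \<Longrightarrow> s \<le> t"
    using cotree_Sup_least[of A t] that by (simp add: eq Sup_cotree_def)
qed

end

inductive tree_le :: "'a tree \<Rightarrow> 'a tree \<Rightarrow> bool" where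
  tree_le_bot: "tree_le Bot t"
| tree_le_leaf: "tree_le (Leaf x) (Leaf x)"
| tree_le_node: "(\<And>b. tree_le (f b) (g b)) \<Longrightarrow> tree_le (Node f) (Node g)"

inductive_simps tree_le_simps [simp]:
  "tree_le Bot t"
  "tree_le (Leaf x) t"
  "tree_le (Node f) t"
  "tree_le t Bot"

instantiation tree :: (type) order
begin

definition less_eq_tree :: "'a tree \<Rightarrow> 'a tree \<Rightarrow> bool" where
  "s \<le> t \<longleftrightarrow> tree_le s t"

definition less_tree :: "'a tree \<Rightarrow> 'a tree \<Rightarrow> bool" where
  "s < t \<longleftrightarrow> s \<le> t \<and> \<not> t \<le> (s :: 'a tree)"

instance
proof
  fix s t u :: "'a tree"
  show "s < t \<longleftrightarrow> s \<le> t \<and> \<not> t \<le> s" by (rule less_tree_def)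
  show "s \<le> s" unfolding less_eq_tree_def by (induction s) auto
  show "s \<le> u" if "s \<le> t" "t \<le> u"
    using that unfolding less_eq_tree_def
    by (induction arbitrary: u rule: tree_le.induct) auto
  show "s = t" if "s \<le> t" "t \<le> s"
    using that unfolding less_eq_tree_def
    by (induction rule: tree_le.induct) auto
qed

end

primrec idl :: "'a cotree \<Rightarrow> nat \<Rightarrow> 'a tree" where
  "idl t 0 = Bot"
| "idl t (Suc i) =
    (case t of
       CoBot \<Rightarrow> Bot
     | CoLeaf x \<Rightarrow> Leaf x
     | CoNode k \<Rightarrow> Node (\<lambda>b. idl (k b) i))"

lemma mono_idl: "mono (idl t)"
proof (rule mono_iff_le_Suc[THEN iffD2], rule allI)
  fix i
  show "idl t i \<le> idl t (Suc i)"
    by (induction i arbitrary: t) (auto simp: less_eq_tree_def split: cotree.split)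
qed

text \<open>
  The continuous extension of a function on finite trees.  It is meaningful for monotone \<open>h\<close>, for
  which the approximations form a chain and \<open>Sup\<close> is the supremum.
\<close>

definition extension :: "('a tree \<Rightarrow> 'c::ccpo) \<Rightarrow> 'a cotree \<Rightarrow> 'c" where
  "extension h t = Sup (range (\<lambda>i. h (idl t i)))"

primrec fold_tree :: "'c \<Rightarrow> ('a \<Rightarrow> 'c) \<Rightarrow> ((bool \<Rightarrow> 'c) \<Rightarrow> 'c) \<Rightarrow> 'a tree \<Rightarrow> 'c" where
  "fold_tree z f g Bot = z"
| "fold_tree z f g (Leaf a) = f a"
| "fold_tree z f g (Node k) = g (fold_tree z f g \<circ> k)"

definition lang :: "'a cotree \<Rightarrow> bool list cotree" where
  "lang = extension
     (fold_tree CoBot (\<lambda>_. CoLeaf []) (\<lambda>g. CoNode (\<lambda>b. map_cotree (Cons b) (g b))))"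

definition filter_cotree :: "('a \<Rightarrow> bool) \<Rightarrow> 'a cotree \<Rightarrow> 'a cotree" where
  "filter_cotree P = extension
     (fold_tree CoBot (\<lambda>a. if P a then CoLeaf a else CoBot) CoNode)"

lemma mono_map_cotree: "mono (map_cotree h)"
proof (rule monoI)
  fix s t :: "'a cotree"
  assume "s \<le> t"
  then have "cotree_le s t" by (simp add: less_eq_cotree_def)
  then have "cotree_le (map_cotree h s) (map_cotree h t)"
  proof (coinduction arbitrary: s t)
    case cotree_le
    then show ?case by (cases s rule: cotree.exhaust) (auto, blast)
  qed
  then show "map_cotree h s \<le> map_cotree h t" by (simp add: less_eq_cotree_def)
qed

lemma mono_fold_tree:
  assumes "\<And>t. z \<le> t" and "mono g"
  shows "mono (fold_tree z f g :: 'a tree \<Rightarrow> 'c::order)"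
proof (rule monoI)
  fix s t :: "'a tree"
  assume "s \<le> t"
  then have "tree_le s t" by (simp add: less_eq_tree_def)
  then show "fold_tree z f g s \<le> fold_tree z f g t"
    by induction (auto simp: assms(1) intro!: monoD[OF assms(2)] le_funI)
qed

lemma mono_lang_fold:
  "mono (fold_tree CoBot (\<lambda>_. CoLeaf []) (\<lambda>g. CoNode (\<lambda>b. map_cotree (Cons b) (g b))))"
  by (rule mono_fold_tree)
    (use mono_map_cotree in \<open>auto simp: mono_def less_eq_cotree_def le_fun_def\<close>)

lemma mono_filter_fold:
  "mono (fold_tree CoBot (\<lambda>a. if P a then CoLeaf a else CoBot) CoNode)"
  by (rule mono_fold_tree) (auto simp: mono_def less_eq_cotree_def le_fun_def)

definition preimage :: "('a \<Rightarrow> bool) \<Rightarrow> 'a cotree \<Rightarrow> bool list cotree" where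
  "preimage P = lang \<circ> filter_cotree P"

definition incomparable :: "'a::order \<Rightarrow> 'a \<Rightarrow> bool"  (infix \<open>\<bowtie>\<close> 50) where
  "x \<bowtie> y \<longleftrightarrow> \<not> (x \<le> y \<or> y \<le> x)"

inductive disjoint_tree :: "'a::order tree \<Rightarrow> bool" where
  "disjoint_tree Bot"
| "disjoint_tree (Leaf x)"
| "(\<And>b. disjoint_tree (k b)) \<Longrightarrow>
    (\<And>x y. x \<in> leaves (k True) \<Longrightarrow> y \<in> leaves (k False) \<Longrightarrow> x \<bowtie> y) \<Longrightarrow>
    disjoint_tree (Node k)"

text \<open>At \<open>bool list\<close> the order is the prefix order.\<close>

definition disjoint_cotree :: "'a::order cotree \<Rightarrow> bool" where
  "disjoint_cotree t \<longleftrightarrow> (\<forall>i. disjoint_tree (idl t i))"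

end

theory Submission imports Defs begin

text \<open>
  Every leaf of \<open>lang s\<close> carries the path from the root to that leaf.  This property is
  coinductive, so it passes to suprema, and it holds of the finite approximations by induction.
  In a tree labelled by paths, leaves on different sides of a node reached by \<open>q\<close> extend
  \<open>q @ [True]\<close> and \<open>q @ [False]\<close> respectively, hence are incomparable.
\<close>

coinductive path_labelled :: "bool list \<Rightarrow> bool list cotree \<Rightarrow> bool" where
  path_labelled_bot: "path_labelled q CoBot"
| path_labelled_leaf: "path_labelled q (CoLeaf q)"
| path_labelled_node: "(\<And>b. path_labelled (q @ [b]) (k b)) \<Longrightarrow> path_labelled q (CoNode k)"

inductive_simps path_labelled_simps [simp]:
  "path_labelled q CoBot"
  "path_labelled q (CoLeaf x)"
  "path_labelled q (CoNode k)"

text \<open>The root of \<open>cotree_Sup A\<close> is copied from a member of \<open>A\<close>, and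
  its child at \<open>b\<close> is the supremum of the children at \<open>b\<close> of members, all
  labelled from \<open>q @ [b]\<close>.\<close>

lemma path_labelled_Sup:
  "\<forall>t \<in> A. path_labelled q t \<Longrightarrow> path_labelled q (cotree_Sup A)"
proof (coinduction arbitrary: q A)
  case path_labelled
  then have lab: "path_labelled q t" if "t \<in> A" for t using that by blast
  consider (leaf) "\<exists>x. CoLeaf x \<in> A"
    | (node) "\<not> (\<exists>x. CoLeaf x \<in> A)" "\<exists>k. CoNode k \<in> A"
    | (bot) "\<not> (\<exists>x. CoLeaf x \<in> A)" "\<not> (\<exists>k. CoNode k \<in> A)"
    by blast
  then show ?case
  proof cases
    case leaf
    then have "CoLeaf (SOME x. CoLeaf x \<in> A) \<in> A" by (rule someI_ex)
    \<comment> \<open>A leaf labelled from \<open>q\<close> can only be \<open>CoLeaf q\<close>, so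
      the choice is forced.\<close>
    from lab[OF this] have "(SOME x. CoLeaf x \<in> A) = q" by simp
    then have "cotree_Sup A = CoLeaf q"
      using leaf by (subst cotree_Sup.code) auto
    then show ?thesis by simp
  next
    case node
    then have "cotree_Sup A = CoNode (\<lambda>b. cotree_Sup {k b | k. CoNode k \<in> A})"
      by (subst cotree_Sup.code) auto
    moreover have "\<forall>t \<in> {k b | k. CoNode k \<in> A}. path_labelled (q @ [b]) t" for b
      using lab by force
    then have "\<exists>q' B. q @ [b] = q' \<and> cotree_Sup {k b | k. CoNode k \<in> A} = cotree_Sup B \<and>
        (\<forall>t \<in> B. path_labelled q' t)" for b
      by (intro exI[of _ "q @ [b]"] exI[of _ "{k b | k. CoNode k \<in> A}"]) simp
    ultimately show ?thesis by (simp add: Ball_def)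
  next
    case bot
    then have "cotree_Sup A = CoBot" by (subst cotree_Sup.code) auto
    then show ?thesis by simp
  qed
qed

text \<open>\<open>lang\<close> builds labels from the front, whereas \<open>path_labelled\<close>
  extends paths at the end. The two agree because
  \<open>(b # q) @ [c] = b # (q @ [c])\<close>.\<close>

lemma path_labelled_map_Cons:
  "path_labelled q t \<Longrightarrow> path_labelled (b # q) (map_cotree (Cons b) t)"
proof (coinduction arbitrary: q t)
  case path_labelled
  show ?case
  proof (cases t)
    case (CoNode k)
    then have "path_labelled (q @ [c]) (k c)" for c
      using path_labelled by simp
    then have "\<exists>q' t'. (b # q) @ [c] = b # q' \<and>
        map_cotree (Cons b) (k c) = map_cotree (Cons b) t' \<and> path_labelled q' t'" for c
      by (intro exI[of _ "q @ [c]"] exI[of _ "k c"]) simp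
    then show ?thesis using CoNode by simp
  qed (use path_labelled in auto)
qed

lemma path_labelled_lang: "path_labelled [] (lang s)"
proof -
  have "path_labelled []
      (fold_tree CoBot (\<lambda>_. CoLeaf []) (\<lambda>g. CoNode (\<lambda>b. map_cotree (Cons b) (g b))) t)"
    for t :: "'a tree"
    \<comment> \<open>At a node, the folded child at \<open>b\<close> is labelled from
      \<open>[]\<close>; prefixing \<open>b\<close> relabels it from \<open>[b]\<close>, the path of
      that child.\<close>
    by (induction t) (auto intro: path_labelled_map_Cons)
  then show ?thesis
    unfolding lang_def extension_def Sup_cotree_def by (auto intro!: path_labelled_Sup)
qed

text \<open>Truncation only replaces subtrees by \<open>Bot\<close>, so surviving leaves keep their
  labels, and the path only grows on the way down.\<close>

lemma prefix_of_leaf: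
  "path_labelled q t \<Longrightarrow> x \<in> leaves (idl t i) \<Longrightarrow> q \<le> x"
proof (induction i arbitrary: q t)
  case (Suc i)
  show ?case
  proof (cases t)
    case (CoNode k)
    then obtain b where "x \<in> leaves (idl (k b) i)" "path_labelled (q @ [b]) (k b)"
      using Suc.prems by auto
    then have "q @ [b] \<le> x" by (rule Suc.IH[rotated])
    then show ?thesis by (auto simp: less_eq_list_def prefix_def)
  qed (use Suc.prems in auto)
qed simp

text \<open>Both lists are longer than \<open>q\<close> and differ at position
  \<open>length q\<close>, so neither is a prefix of the other.\<close>

lemma incomparable_extensions:
  assumes "q @ [True] \<le> x" "q @ [False] \<le> (y :: bool list)"
  shows "x \<bowtie> y"
  using assms by (auto simp: incomparable_def less_eq_list_def prefix_def)

lemma disjoint_idl_if_path_labelled: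
  "path_labelled q t \<Longrightarrow> disjoint_tree (idl t i)"
proof (induction i arbitrary: q t)
  case (Suc i)
  show ?case
  proof (cases t)
    case (CoNode k)
    then have k: "path_labelled (q @ [b]) (k b)" for b
      using Suc.prems by simp
    have "disjoint_tree (Node (\<lambda>b. idl (k b) i))"
      \<comment> \<open>The induction hypothesis handles each child from its own path
        \<open>q @ [b]\<close>; the labels separate the two sides.\<close>
      using Suc.IH[OF k] incomparable_extensions prefix_of_leaf[OF k]
      by (intro disjoint_tree.intros) blast+
    then show ?thesis using CoNode by simp
  qed (simp_all add: disjoint_tree.intros)
qed (simp add: disjoint_tree.intros)

theorem mainTheorem3:
  fixes P :: "'a \<Rightarrow> bool" and t :: "'a cotree"
  shows "disjoint_cotree (preimage P t)"
  using disjoint_idl_if_path_labelled[OF path_labelled_lang[of "filter_cotree P t"]]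
  by (simp add: disjoint_cotree_def preimage_def)

end
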